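(* Let $(X,d)$ be a proper geodesic Gromov hyperbolic metric space and let $f\colon X\to X$ be a non-expanding self-map. Let $p\in X$ and let $\eta\in\partial_GX$ be a boundary regular fixed point of $f$. Then for all $n\ge2$ the point $\eta$ is also a boundary regular fixed point of $f^n$. Moreover, the sequence $\left(\frac1n\log\lambda_{\eta,p}(f^n)\right)_{n\ge1}$ is bounded.
   Context: Non-expanding: $d(f(x),f(y))\le d(x,y)$. Gromov hyperbolic: for some $\delta>0$, in every geodesic triangle each side lies in the $\delta$-neighborhood of the union of the other two. $\partial_GX$ is the Gromov boundary; convergence to boundary points is in the Gromov compactification $\overline X^G$. For a non-expanding $g\colon X\to X$, the dilation at $\eta\in\partial_GX$ with base point $p$ is given by $\log\lambda_{\eta,p}(g)=\liminf_{z\to\eta}[d(z,p)-d(g(z),p)]$; its finiteness is independent of $p$. Geodesic region: $\{x\in X: d(x,\gamma)<R\}$ for a geodesic ray $\gamma$ and $R>0$, with vertex $[\gamma]\in\partial_GX$. $g$ has geodesic limit $\xi$ at $\eta$ if $g(x_n)\to\xi$ for every sequence $x_n\to\eta$ contained in a geodesic region with vertex $\eta$. $\eta$ is a boundary regular fixed point (BRFP) of $g$ if $\lambda_{\eta,p}(g)<+\infty$ and $g$ has geodesic limit $\eta$ at $\eta$. *)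

theory Defs
  imports "HOL-Analysis.Analysis"
begin

section \<open>Proper geodesic Gromov hyperbolic spaces\<close>

definition proper_space :: "'a::metric_space itself \<Rightarrow> bool" where
  "proper_space _ \<longleftrightarrow> (\<forall>(x::'a) r. compact (cball x r))"

text \<open>\<open>geodesic_segment S x y\<close>: the set \<open>S\<close> is the trace of a geodesic from \<open>x\<close> to \<open>y\<close>.\<close>

definition geodesic_segment :: "'a::metric_space set \<Rightarrow> 'a \<Rightarrow> 'a \<Rightarrow> bool" where
  "geodesic_segment S x y \<longleftrightarrow>
     (\<exists>g :: real \<Rightarrow> 'a. g 0 = x \<and> g (dist x y) = y \<and>
        (\<forall>s\<in>{0..dist x y}. \<forall>t\<in>{0..dist x y}. dist (g s) (g t) = \<bar>s - t\<bar>) \<and>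
        S = g ` {0..dist x y})"

definition geodesic_space :: "'a::metric_space itself \<Rightarrow> bool" where
  "geodesic_space _ \<longleftrightarrow> (\<forall>x y :: 'a. \<exists>S. geodesic_segment S x y)"

text \<open>It suffices to constrain the first side of every triangle, since the cyclic relabellings
  of a triangle are again among the triangles quantified over.\<close>

definition gromov_hyperbolic :: "'a::metric_space itself \<Rightarrow> bool" where
  "gromov_hyperbolic _ \<longleftrightarrow>
     (\<exists>\<delta>>0. \<forall>(x::'a) y z S T U.
        geodesic_segment S x y \<longrightarrow> geodesic_segment T y z \<longrightarrow> geodesic_segment U z x \<longrightarrow>
        (\<forall>s\<in>S. \<exists>w\<in>T \<union> U. dist s w < \<delta>))"

section \<open>Gromov boundary and Gromov compactification\<close>

text \<open>Rays are parametrised by \<open>[0,\<infinity>)\<close>; the values of the total function at negative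
  arguments are irrelevant in all that follows.\<close>

definition geodesic_ray :: "(real \<Rightarrow> 'a::metric_space) \<Rightarrow> bool" where
  "geodesic_ray \<gamma> \<longleftrightarrow> (\<forall>s\<ge>0. \<forall>t\<ge>0. dist (\<gamma> s) (\<gamma> t) = \<bar>s - t\<bar>)"

definition asymptotic :: "((real \<Rightarrow> 'a::metric_space) \<times> (real \<Rightarrow> 'a)) set" where
  "asymptotic =
     {(\<gamma>, \<sigma>). geodesic_ray \<gamma> \<and> geodesic_ray \<sigma> \<and> (\<exists>C. \<forall>t\<ge>0. dist (\<gamma> t) (\<sigma> t) \<le> C)}"

definition gromov_boundary :: "(real \<Rightarrow> 'a::metric_space) set set" where
  "gromov_boundary = {\<gamma>. geodesic_ray \<gamma>} // asymptotic"

lemma equiv_asymptotic: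
  "equiv {\<gamma> :: real \<Rightarrow> 'a::metric_space. geodesic_ray \<gamma>} asymptotic"
proof (rule equivI)
  show "asymptotic \<subseteq> {\<gamma>. geodesic_ray \<gamma>} \<times> {\<gamma> :: real \<Rightarrow> 'a. geodesic_ray \<gamma>}"
    by (auto simp: asymptotic_def)
  show "refl_on {\<gamma> :: real \<Rightarrow> 'a. geodesic_ray \<gamma>} asymptotic"
    by (auto simp: refl_on_def asymptotic_def)
  show "sym (asymptotic :: ((real \<Rightarrow> 'a) \<times> _) set)"
    by (auto simp: sym_def asymptotic_def dist_commute)
  show "trans (asymptotic :: ((real \<Rightarrow> 'a) \<times> _) set)"
  proof (rule transI)
    fix a b c :: "real \<Rightarrow> 'a"
    assume ab: "(a, b) \<in> asymptotic" and bc: "(b, c) \<in> asymptotic"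
    obtain C D where "\<forall>t\<ge>0. dist (a t) (b t) \<le> C" "\<forall>t\<ge>0. dist (b t) (c t) \<le> D"
      using ab bc by (auto simp: asymptotic_def)
    then have "\<forall>t\<ge>0. dist (a t) (c t) \<le> C + D"
      by (meson add_mono dist_triangle order_trans)
    then show "(a, c) \<in> asymptotic"
      using ab bc by (auto simp: asymptotic_def)
  qed
qed

definition gromov_product :: "'a::metric_space \<Rightarrow> 'a \<Rightarrow> 'a \<Rightarrow> real" where
  "gromov_product b x y = (dist x b + dist y b - dist x y) / 2"

text \<open>Points of the compactification \<open>X \<squnion> \<partial>X\<close> are tagged by \<open>Inl\<close> (points of \<open>X\<close>) and
  \<open>Inr\<close> (boundary points).\<close>

type_synonym 'a gromov_point = "'a + (real \<Rightarrow> 'a) set"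

text \<open>The standard basic neighbourhood of radius \<open>R\<close> of a boundary point \<open>\<eta>\<close>, with respect
  to the base point \<open>b\<close>: all points, inside or at infinity, whose Gromov product with \<open>\<eta>\<close>,
  taken as a lower limit along representing rays, is at least \<open>R\<close>.\<close>

definition gromov_nhd :: "'a::metric_space \<Rightarrow> (real \<Rightarrow> 'a) set \<Rightarrow> real \<Rightarrow> 'a gromov_point set" where
  "gromov_nhd b \<eta> R =
     Inl ` {x. \<exists>\<gamma>\<in>\<eta>. ereal R \<le> Liminf at_top (\<lambda>t. ereal (gromov_product b x (\<gamma> t)))} \<union>
     Inr ` {\<zeta>\<in>gromov_boundary. \<exists>\<gamma>\<in>\<eta>. \<exists>\<sigma>\<in>\<zeta>.
        ereal R \<le> Liminf (at_top \<times>\<^sub>F at_top) (\<lambda>(s, t). ereal (gromov_product b (\<gamma> s) (\<sigma> t)))}"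

text \<open>Gromov products for two base points differ by at most the distance of the base points, so
  \<open>\<forall>b\<close> could equivalently be replaced by any fixed \<open>b\<close>.\<close>

definition gromov_open :: "'a::metric_space gromov_point set \<Rightarrow> bool" where
  "gromov_open U \<longleftrightarrow>
     U \<subseteq> range Inl \<union> Inr ` gromov_boundary \<and>
     open {x. Inl x \<in> U} \<and>
     (\<forall>\<eta>. Inr \<eta> \<in> U \<longrightarrow> (\<forall>b. \<exists>R. gromov_nhd b \<eta> R \<subseteq> U))"

definition gromov_compactification :: "'a::metric_space gromov_point topology" where
  "gromov_compactification = topology gromov_open"

lemma gromov_nhd_antimono:
  assumes "R \<le> R'"
  shows "gromov_nhd b \<eta> R' \<subseteq> gromov_nhd b \<eta> R"
proof -
  have "ereal R \<le> l" if "ereal R' \<le> l" for l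
    using assms that by (meson ereal_less_eq(3) order_trans)
  then show ?thesis
    unfolding gromov_nhd_def by (intro Un_mono image_mono subsetI) blast+
qed

lemma istopology_gromov_open: "istopology (gromov_open :: 'a::metric_space gromov_point set \<Rightarrow> bool)"
  unfolding istopology_def
proof (intro conjI allI impI)
  fix S T :: "'a gromov_point set"
  assume S: "gromov_open S" and T: "gromov_open T"
  show "gromov_open (S \<inter> T)"
    unfolding gromov_open_def
  proof (intro conjI allI impI)
    show "S \<inter> T \<subseteq> range Inl \<union> Inr ` gromov_boundary"
      using S by (auto simp: gromov_open_def)
    have "{x. Inl x \<in> S \<inter> T} = {x. Inl x \<in> S} \<inter> {x. Inl x \<in> T}"
      by auto
    then show "open {x. Inl x \<in> S \<inter> T}"
      using S T by (simp add: gromov_open_def open_Int)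
    fix \<eta> b assume "Inr \<eta> \<in> S \<inter> T"
    then obtain R R' where "gromov_nhd b \<eta> R \<subseteq> S" "gromov_nhd b \<eta> R' \<subseteq> T"
      using S T unfolding gromov_open_def by blast
    then have "gromov_nhd b \<eta> (max R R') \<subseteq> S \<inter> T"
      using gromov_nhd_antimono[of R "max R R'" b \<eta>] gromov_nhd_antimono[of R' "max R R'" b \<eta>] by auto
    then show "\<exists>R. gromov_nhd b \<eta> R \<subseteq> S \<inter> T" ..
  qed
next
  fix \<K> :: "'a gromov_point set set"
  assume K: "\<forall>K\<in>\<K>. gromov_open K"
  show "gromov_open (\<Union>\<K>)"
    unfolding gromov_open_def
  proof (intro conjI allI impI)
    show "\<Union>\<K> \<subseteq> range Inl \<union> Inr ` gromov_boundary"
      using K unfolding gromov_open_def by blast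
    have "{x. Inl x \<in> \<Union>\<K>} = (\<Union>K\<in>\<K>. {x. Inl x \<in> K})"
      by auto
    then show "open {x. Inl x \<in> \<Union>\<K>}"
      using K by (auto simp: gromov_open_def)
    fix \<eta> b assume "Inr \<eta> \<in> \<Union>\<K>"
    then show "\<exists>R. gromov_nhd b \<eta> R \<subseteq> \<Union>\<K>"
      using K unfolding gromov_open_def by (meson Union_iff Union_upper order_trans)
  qed
qed

lemma openin_gromov_compactification:
  "openin gromov_compactification U \<longleftrightarrow> gromov_open U"
  by (simp add: gromov_compactification_def topology_inverse' istopology_gromov_open)

lemma topspace_gromov_compactification:
  "topspace (gromov_compactification :: 'a::metric_space gromov_point topology)
     = range Inl \<union> Inr ` gromov_boundary"
proof
  show "topspace gromov_compactification \<subseteq> range Inl \<union> Inr ` gromov_boundary"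
    using openin_topspace[of gromov_compactification]
    unfolding openin_gromov_compactification gromov_open_def by blast
  have "gromov_open (range Inl \<union> Inr ` gromov_boundary :: 'a gromov_point set)"
    by (auto simp: gromov_open_def gromov_nhd_def)
  then show "range Inl \<union> Inr ` gromov_boundary
      \<subseteq> topspace (gromov_compactification :: 'a gromov_point topology)"
    by (metis openin_gromov_compactification openin_subset)
qed

section \<open>Dilation and boundary regular fixed points\<close>

text \<open>The filter of \<open>z \<rightarrow> \<eta>\<close> with \<open>z \<in> X\<close>: the trace on \<open>X\<close> of the neighbourhoods of \<open>\<eta>\<close>.\<close>

definition to_boundary :: "(real \<Rightarrow> 'a::metric_space) set \<Rightarrow> 'a filter" where
  "to_boundary \<eta> = filtercomap Inl (nhdsin gromov_compactification (Inr \<eta>))"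

text \<open>This is \<open>log \<lambda>\<close>, with values in the extended reals; \<open>\<lambda> < \<infinity>\<close> thus means that it
  is \<open>< \<infinity>\<close>.\<close>

definition log_dilation ::
    "(real \<Rightarrow> 'a::metric_space) set \<Rightarrow> 'a \<Rightarrow> ('a \<Rightarrow> 'a) \<Rightarrow> ereal" where
  "log_dilation \<eta> p g = Liminf (to_boundary \<eta>) (\<lambda>z. ereal (dist z p - dist (g z) p))"

lemma log_dilation_base_point:
  "log_dilation \<eta> q g \<le> log_dilation \<eta> p g + ereal (2 * dist p q)"
proof -
  have "dist z q - dist (g z) q \<le> dist z p - dist (g z) p + 2 * dist p q" for z
    using dist_triangle[of z q p] dist_triangle[of "g z" p q] by (simp add: dist_commute)
  then have "log_dilation \<eta> q g
      \<le> Liminf (to_boundary \<eta>) (\<lambda>z. ereal (2 * dist p q) + ereal (dist z p - dist (g z) p))"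
    unfolding log_dilation_def by (intro Liminf_mono always_eventually) (simp add: add.commute)
  also have "\<dots> \<le> ereal (2 * dist p q) + log_dilation \<eta> p g"
  proof (cases "to_boundary \<eta> = bot")
    case True
    then show ?thesis by (simp add: log_dilation_def top_ereal_def)
  next
    case False
    then show ?thesis by (simp add: log_dilation_def Liminf_add_ereal_left del: plus_ereal.simps)
  qed
  finally show ?thesis by (simp add: add.commute)
qed

definition geodesic_region :: "(real \<Rightarrow> 'a::metric_space) \<Rightarrow> real \<Rightarrow> 'a set" where
  "geodesic_region \<gamma> R = {x. infdist x (\<gamma> ` {0..}) < R}"

text \<open>The rays with vertex \<open>\<eta>\<close> are precisely the elements of the equivalence class \<open>\<eta>\<close>.\<close>

definition has_geodesic_limit ::
    "('a::metric_space \<Rightarrow> 'a) \<Rightarrow> 'a gromov_point \<Rightarrow> (real \<Rightarrow> 'a) set \<Rightarrow> bool" where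
  "has_geodesic_limit g \<xi> \<eta> \<longleftrightarrow>
     (\<forall>\<gamma>\<in>\<eta>. \<forall>R>0. \<forall>x :: nat \<Rightarrow> 'a.
        (\<forall>n. x n \<in> geodesic_region \<gamma> R) \<longrightarrow>
        limitin gromov_compactification (\<lambda>n. Inl (x n)) (Inr \<eta>) sequentially \<longrightarrow>
        limitin gromov_compactification (\<lambda>n. Inl (g (x n))) \<xi> sequentially)"

text \<open>By \<open>log_dilation_base_point\<close>, finiteness of the dilation does not depend on \<open>p\<close>.\<close>

definition boundary_regular_fixed_point ::
    "('a::metric_space \<Rightarrow> 'a) \<Rightarrow> (real \<Rightarrow> 'a) set \<Rightarrow> bool" where
  "boundary_regular_fixed_point g \<eta> \<longleftrightarrow>
     \<eta> \<in> gromov_boundary \<and> (\<forall>p. log_dilation \<eta> p g < \<infinity>) \<and> has_geodesic_limit g (Inr \<eta>) \<eta>"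

end

theory Submission
  imports Defs
begin

text \<open>Let \<open>\<gamma>\<close> be a ray with vertex \<open>\<eta>\<close>. Finiteness of the dilation of \<open>f\<close> at \<open>\<eta>\<close> gives points \<open>z \<rightarrow> \<eta>\<close>
  with \<open>dist z (\<gamma> 0) - dist (f z) (\<gamma> 0)\<close> bounded above. As \<open>f\<close> is non-expanding, \<open>f \<circ> \<gamma>\<close> then moves
  away from \<open>\<gamma> 0\<close> at unit speed up to an additive constant, and it converges to \<open>\<eta>\<close> by the geodesic
  limit, so hyperbolicity keeps \<open>f (\<gamma> t)\<close> within some \<open>B\<close> of \<open>\<gamma> t\<close>. Hence \<open>f\<^sup>n\<close> moves every \<open>\<gamma> t\<close> by
  at most \<open>n B\<close>. This gives the geodesic limit of \<open>f\<^sup>n\<close> and \<open>log \<lambda>(f\<^sup>n) \<le> n B\<close>, while the triangle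
  inequality gives \<open>log \<lambda>(f\<^sup>n) \<ge> - n dist (f p) p\<close>.\<close>

section \<open>The four-point inequality\<close>

text \<open>Gromov's product form of hyperbolicity, with one constant for all base points. Unlike
  slim triangles it involves no geodesics, so it applies directly to points on rays and their images
  under \<open>f\<close>.\<close>

definition four_point_hyperbolic :: "'a::metric_space itself \<Rightarrow> real \<Rightarrow> bool" where
  "four_point_hyperbolic _ c \<longleftrightarrow> (\<forall>(b::'a) x y z.
     min (gromov_product b x y) (gromov_product b y z) - c \<le> gromov_product b x z)"

lemma four_point_hyperbolicD:
  assumes "four_point_hyperbolic TYPE('a::metric_space) c"
    and "r \<le> gromov_product b (x::'a) y" and "r \<le> gromov_product b y z"
  shows "r - c \<le> gromov_product b x z"
proof -
  have "min (gromov_product b x y) (gromov_product b y z) - c \<le> gromov_product b x z"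
    using assms(1) unfolding four_point_hyperbolic_def by blast
  with assms(2,3) show ?thesis by linarith
qed

lemma gromov_product_commute: "gromov_product b x y = gromov_product b y x"
  by (simp add: gromov_product_def dist_commute)

text \<open>Each of the two distances to the base point changes by at most \<open>dist b b'\<close>,
  and the product halves their sum.\<close>

lemma gromov_product_change_base:
  "gromov_product b x y - dist b b' \<le> gromov_product b' x y"
  using dist_triangle[of x b b'] dist_triangle[of y b b']
  by (simp add: gromov_product_def dist_commute field_simps)

lemma gromov_product_change_point:
  "gromov_product b x y - dist x x' \<le> gromov_product b x' y"
  using dist_triangle[of x b x'] dist_triangle[of x' y x]
  by (simp add: gromov_product_def dist_commute field_simps)

lemma geodesic_segment_dist:
  assumes "geodesic_segment S x y" "w \<in> S"
  shows "dist x w + dist w y = dist x y"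
proof -
  obtain g where g: "g 0 = x" "g (dist x y) = y" "S = g ` {0..dist x y}"
    and iso: "\<forall>s\<in>{0..dist x y}. \<forall>t\<in>{0..dist x y}. dist (g s) (g t) = \<bar>s - t\<bar>"
    using assms(1) unfolding geodesic_segment_def by blast
  obtain t where t: "t \<in> {0..dist x y}" "w = g t" using assms(2) g(3) by blast
  have "dist (g 0) (g t) = t" "dist (g t) (g (dist x y)) = dist x y - t"
    using iso[rule_format, of 0 t] iso[rule_format, of t "dist x y"] t(1) by auto
  then show ?thesis using g t by simp
qed

lemma geodesic_segment_ends: "geodesic_segment S x y \<Longrightarrow> x \<in> S \<and> y \<in> S"
  unfolding geodesic_segment_def
  by (metis atLeastAtMost_iff imageI order_refl zero_le_dist)

lemma connected_geodesic_segment: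
  assumes "geodesic_segment S x y"
  shows "connected S"
proof -
  obtain g where S: "S = g ` {0..dist x y}"
    and iso: "\<forall>s\<in>{0..dist x y}. \<forall>t\<in>{0..dist x y}. dist (g s) (g t) = \<bar>s - t\<bar>"
    using assms unfolding geodesic_segment_def by blast
  have "continuous_on {0..dist x y} g"
    unfolding continuous_on_iff using iso by (metis dist_real_def)
  then show ?thesis unfolding S by (intro connected_continuous_image) auto
qed

text \<open>Since \<open>w\<close> splits \<open>dist x y\<close> additively, adding the triangle
  inequalities from \<open>x\<close> and from \<open>y\<close> to \<open>b\<close> through
  \<open>w\<close> leaves only \<open>2 * dist b w\<close>.\<close>

lemma gromov_product_le_dist_segment:
  assumes "geodesic_segment S x y" "w \<in> S"
  shows "gromov_product b x y \<le> dist b w"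
  using geodesic_segment_dist[OF assms] dist_triangle[of x b w] dist_triangle[of y b w]
  by (simp add: gromov_product_def dist_commute)

lemma dist_near_segment:
  assumes "geodesic_segment S x b" "v \<in> S" "dist w v < \<delta>"
  shows "dist b w + dist w x \<le> dist x b + 2 * \<delta>"
  using geodesic_segment_dist[OF assms(1,2)] assms(3) dist_triangle[of b w v] dist_triangle[of w x v]
  by (simp add: dist_commute)

text \<open>By connectedness some point of a side is close to both other sides; it then nearly
  minimises the distance to the opposite vertex.\<close>

lemma slim_segment_point:
  fixes x y b :: "'a::metric_space"
  assumes geo: "geodesic_space TYPE('a)"
    and slim: "\<And>(x::'a) y z S T U s. geodesic_segment S x y \<Longrightarrow> geodesic_segment T y z \<Longrightarrow>
      geodesic_segment U z x \<Longrightarrow> s \<in> S \<Longrightarrow> \<exists>w\<in>T \<union> U. dist s w < \<delta>"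
    and "\<delta> > 0" and S: "geodesic_segment S x y"
  shows "\<exists>w\<in>S. dist b w \<le> gromov_product b x y + 2 * \<delta>"
proof -
  obtain T U where T: "geodesic_segment T y b" and U: "geodesic_segment U b x"
    using geo unfolding geodesic_space_def by blast
  \<comment> \<open>The open \<delta>-neighbourhoods of the two other sides cover \<open>S\<close>,
    and each contains an endpoint of \<open>S\<close>. Connectedness then yields a point of
    \<open>S\<close> in both.\<close>
  define A where "A = (\<Union>v\<in>T. ball v \<delta>)"
  define B where "B = (\<Union>v\<in>U. ball v \<delta>)"
  have "S \<subseteq> A \<union> B"
  proof
    fix w assume "w \<in> S"
    with slim[OF S T U] obtain v where "v \<in> T \<union> U" "dist w v < \<delta>" by blast
    then show "w \<in> A \<union> B" by (auto simp: A_def B_def dist_commute)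
  qed
  moreover have "y \<in> A \<inter> S" "x \<in> B \<inter> S"
    using geodesic_segment_ends[OF S] geodesic_segment_ends[OF T] geodesic_segment_ends[OF U] \<open>\<delta> > 0\<close>
    unfolding A_def B_def by (meson IntI UN_I centre_in_ball)+
  moreover have "open A" "open B" by (auto simp: A_def B_def)
  ultimately have "A \<inter> B \<inter> S \<noteq> {}"
    using connected_geodesic_segment[OF S] unfolding connected_def by blast
  then obtain w u v where w: "w \<in> S" "u \<in> T" "dist w u < \<delta>" "v \<in> U" "dist w v < \<delta>"
    by (auto simp: A_def B_def dist_commute)
  have "dist b v + dist v x = dist b x" using geodesic_segment_dist[OF U w(4)] .
  then have "dist b w + dist w x \<le> dist x b + 2 * \<delta>"
    using w(5) dist_triangle[of b w v] dist_triangle[of w x v] by (simp add: dist_commute)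
  moreover have "dist b w + dist w y \<le> dist y b + 2 * \<delta>"
    using dist_near_segment[OF T w(2,3)] .
  \<comment> \<open>Adding the two estimates gives \<open>2 * dist b w\<close> plus
    \<open>dist w x + dist w y\<close>, and the latter sum is at least
    \<open>dist x y\<close>.\<close>
  ultimately have "dist b w \<le> gromov_product b x y + 2 * \<delta>"
    using dist_triangle[of x y w] by (simp add: gromov_product_def dist_commute field_simps)
  with w(1) show ?thesis by blast
qed

lemma gromov_hyperbolic_four_point:
  assumes geo: "geodesic_space TYPE('a::metric_space)" and "gromov_hyperbolic TYPE('a)"
  shows "\<exists>c\<ge>0. four_point_hyperbolic TYPE('a) c"
proof -
  obtain \<delta> :: real where "\<delta> > 0" and
    slim: "\<And>(x::'a) y z S T U s. geodesic_segment S x y \<Longrightarrow> geodesic_segment T y z \<Longrightarrow>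
      geodesic_segment U z x \<Longrightarrow> s \<in> S \<Longrightarrow> \<exists>w\<in>T \<union> U. dist s w < \<delta>"
    using assms(2) unfolding gromov_hyperbolic_def by metis
  \<comment> \<open>Of the constant, \<open>2 * \<delta>\<close> comes from the point of
    \<open>S\<close> nearly realising the product and one more \<delta> from passing to an adjacent
    side.\<close>
  have "min (gromov_product b x y) (gromov_product b y z) - 3 * \<delta> \<le> gromov_product b x z"
    for b x y z :: 'a
  proof -
    obtain S T U where S: "geodesic_segment S x z" and T: "geodesic_segment T z y"
      and U: "geodesic_segment U y x"
      using geo unfolding geodesic_space_def by blast
    have "\<exists>w\<in>S. dist b w \<le> gromov_product b x z + 2 * \<delta>"
      by (rule slim_segment_point[OF geo _ \<open>\<delta> > 0\<close> S]) (rule slim)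
    then obtain w where w: "w \<in> S" "dist b w \<le> gromov_product b x z + 2 * \<delta>" by blast
    obtain v where v: "v \<in> T \<union> U" "dist w v < \<delta>"
      using slim[OF S T U w(1)] by blast
    have "min (gromov_product b x y) (gromov_product b y z) \<le> dist b v"
      using v(1) gromov_product_le_dist_segment[OF T, of v b]
        gromov_product_le_dist_segment[OF U, of v b]
      by (auto simp: gromov_product_commute[of b z y] gromov_product_commute[of b y x])
    then show ?thesis using w(2) v(2) dist_triangle[of b v w] by linarith
  qed
  then have "four_point_hyperbolic TYPE('a) (3 * \<delta>)"
    unfolding four_point_hyperbolic_def by blast
  with \<open>\<delta> > 0\<close> show ?thesis by (intro exI[of _ "3 * \<delta>"]) auto
qed

section \<open>Neighbourhoods of boundary points\<close>

lemma gromov_boundary_nonempty: "\<eta> \<in> gromov_boundary \<Longrightarrow> \<exists>\<gamma>. \<gamma> \<in> \<eta>"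
  using in_quotient_imp_non_empty[OF equiv_asymptotic] unfolding gromov_boundary_def by blast

lemma gromov_boundary_geodesic_ray:
  "\<eta> \<in> gromov_boundary \<Longrightarrow> \<gamma> \<in> \<eta> \<Longrightarrow> geodesic_ray \<gamma>"
  using in_quotient_imp_subset[OF equiv_asymptotic] unfolding gromov_boundary_def by blast

lemma gromov_boundary_asymptotic:
  "\<eta> \<in> gromov_boundary \<Longrightarrow> \<gamma> \<in> \<eta> \<Longrightarrow> \<sigma> \<in> \<eta> \<Longrightarrow> (\<gamma>, \<sigma>) \<in> asymptotic"
  using in_quotient_imp_in_rel[OF equiv_asymptotic] unfolding gromov_boundary_def by blast

text \<open>The distances to \<open>b\<close> are at least \<open>s\<close> and \<open>t\<close> up
  to constants, and the distance between the points is at most \<bar>s - t\<bar> plus a constant. As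
  \<open>s + t - \<bar>s - t\<bar>\<close> is twice the minimum, the product tends to
  infinity.\<close>

lemma asymptotic_gromov_product:
  assumes "(\<gamma>, \<sigma>) \<in> asymptotic"
  shows "\<exists>T\<ge>0. \<forall>s\<ge>T. \<forall>t\<ge>T. r \<le> gromov_product b (\<gamma> s) (\<sigma> t)"
proof -
  obtain C where ray: "geodesic_ray \<gamma>" "geodesic_ray \<sigma>" and C: "\<And>t. t \<ge> 0 \<Longrightarrow> dist (\<gamma> t) (\<sigma> t) \<le> C"
    using assms by (auto simp: asymptotic_def)
  define T where "T = \<bar>r\<bar> + dist (\<gamma> 0) b + dist (\<sigma> 0) b + \<bar>C\<bar>"
  have "r \<le> gromov_product b (\<gamma> s) (\<sigma> t)" if "s \<ge> T" "t \<ge> T" for s t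
  proof -
    have "T \<ge> 0" by (simp add: T_def)
    have st: "dist (\<gamma> s) (\<gamma> 0) = s" "dist (\<sigma> t) (\<sigma> 0) = t" "dist (\<gamma> s) (\<gamma> t) = \<bar>s - t\<bar>"
      using ray that \<open>T \<ge> 0\<close> by (auto simp: geodesic_ray_def)
    have 1: "s \<le> dist (\<gamma> s) b + dist (\<gamma> 0) b" "t \<le> dist (\<sigma> t) b + dist (\<sigma> 0) b"
      using st(1,2) dist_triangle[of "\<gamma> s" "\<gamma> 0" b] dist_triangle[of "\<sigma> t" "\<sigma> 0" b]
      by (simp_all add: dist_commute)
    have 2: "dist (\<gamma> s) (\<sigma> t) \<le> \<bar>s - t\<bar> + C"
      using st(3) C[of t] that \<open>T \<ge> 0\<close> dist_triangle[of "\<gamma> s" "\<sigma> t" "\<gamma> t"] by linarith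
    have "2 * r \<le> s + t - dist (\<gamma> 0) b - dist (\<sigma> 0) b - (\<bar>s - t\<bar> + C)"
      using that zero_le_dist[of "\<gamma> 0" b] zero_le_dist[of "\<sigma> 0" b] unfolding T_def by arith
    then show ?thesis using 1 2 by (simp add: gromov_product_def)
  qed
  moreover have "T \<ge> 0" by (simp add: T_def)
  ultimately show ?thesis by blast
qed

lemma eventually_at_top_prod_real:
  "eventually P (at_top \<times>\<^sub>F at_top :: (real \<times> real) filter) \<longleftrightarrow> (\<exists>T. \<forall>s\<ge>T. \<forall>t\<ge>T. P (s, t))"
proof
  assume "eventually P (at_top \<times>\<^sub>F at_top)"
  then obtain P1 P2 where P: "eventually P1 (at_top::real filter)" "eventually P2 (at_top::real filter)"
    "\<And>s t. P1 s \<Longrightarrow> P2 t \<Longrightarrow> P (s, t)" unfolding eventually_prod_filter by blast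
  then obtain T1 T2 where "\<forall>s\<ge>T1. P1 s" "\<forall>t\<ge>T2. P2 t"
    by (auto simp: eventually_at_top_linorder)
  with P(3) show "\<exists>T. \<forall>s\<ge>T. \<forall>t\<ge>T. P (s, t)" by (intro exI[of _ "max T1 T2"]) auto
next
  assume "\<exists>T. \<forall>s\<ge>T. \<forall>t\<ge>T. P (s, t)"
  then obtain T where "\<forall>s\<ge>T. \<forall>t\<ge>T. P (s, t)" ..
  then show "eventually P (at_top \<times>\<^sub>F at_top)"
    unfolding eventually_prod_filter
    by (intro exI[of _ "\<lambda>s. s \<ge> T"] conjI eventually_ge_at_top) auto
qed

lemma gromov_nhd_InlI:
  assumes "\<gamma> \<in> \<eta>" "\<And>t. t \<ge> T \<Longrightarrow> R \<le> gromov_product b x (\<gamma> t)"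
  shows "Inl x \<in> gromov_nhd b \<eta> R"
proof -
  have "ereal R \<le> Liminf at_top (\<lambda>t. ereal (gromov_product b x (\<gamma> t)))"
    using assms(2) by (intro Liminf_bounded) (auto simp: eventually_at_top_linorder)
  with assms(1) show ?thesis unfolding gromov_nhd_def by blast
qed

lemma gromov_nhd_InrI:
  assumes "\<zeta> \<in> gromov_boundary" "\<gamma> \<in> \<eta>" "\<sigma> \<in> \<zeta>"
    "\<And>s t. s \<ge> T \<Longrightarrow> t \<ge> T \<Longrightarrow> R \<le> gromov_product b (\<gamma> s) (\<sigma> t)"
  shows "Inr \<zeta> \<in> gromov_nhd b \<eta> R"
proof -
  have "ereal R \<le> Liminf (at_top \<times>\<^sub>F at_top) (\<lambda>(s, t). ereal (gromov_product b (\<gamma> s) (\<sigma> t)))"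
    using assms(4) by (intro Liminf_bounded) (auto simp: eventually_at_top_prod_real)
  with assms(1-3) show ?thesis unfolding gromov_nhd_def by blast
qed

text \<open>The loss of \<open>1\<close> pays for passing from a lower limit to eventual values, the loss of \<open>c\<close> for
  changing the representing ray.\<close>

lemma gromov_nhd_InlD:
  fixes x :: "'a::metric_space"
  assumes hyp: "four_point_hyperbolic TYPE('a) c" and "\<eta> \<in> gromov_boundary"
    and "Inl x \<in> gromov_nhd b \<eta> R" and "\<gamma> \<in> \<eta>"
  shows "\<exists>T. \<forall>t\<ge>T. R - 1 - c \<le> gromov_product b x (\<gamma> t)"
proof -
  obtain \<sigma> where \<sigma>: "\<sigma> \<in> \<eta>" "ereal R \<le> Liminf at_top (\<lambda>t. ereal (gromov_product b x (\<sigma> t)))"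
    using assms(3) unfolding gromov_nhd_def by blast
  have "ereal (R - 1) < Liminf at_top (\<lambda>t. ereal (gromov_product b x (\<sigma> t)))"
    using \<sigma>(2) by (rule less_le_trans[rotated]) simp
  from less_LiminfD[OF this] obtain T1 where T1: "\<And>t. t \<ge> T1 \<Longrightarrow> R - 1 \<le> gromov_product b x (\<sigma> t)"
    by (force simp: eventually_at_top_linorder intro: less_imp_le)
  obtain T2 where T2: "\<And>s t. s \<ge> T2 \<Longrightarrow> t \<ge> T2 \<Longrightarrow> R - 1 \<le> gromov_product b (\<sigma> s) (\<gamma> t)"
    using asymptotic_gromov_product[OF gromov_boundary_asymptotic[OF assms(2) \<sigma>(1) assms(4)]] by blast
  have "R - 1 - c \<le> gromov_product b x (\<gamma> t)" if "t \<ge> max T1 T2" for t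
    using that by (intro four_point_hyperbolicD[OF hyp T1 T2]) auto
  then show ?thesis by blast
qed

text \<open>Here both representing rays are replaced, so the constant \<open>c\<close> is lost
  twice.\<close>

lemma gromov_nhd_InrD:
  fixes b :: "'a::metric_space"
  assumes hyp: "four_point_hyperbolic TYPE('a) c" and "c \<ge> 0" and "\<eta> \<in> gromov_boundary"
    and "Inr \<zeta> \<in> gromov_nhd b \<eta> R" and "\<gamma> \<in> \<eta>" "\<sigma> \<in> \<zeta>"
  shows "\<zeta> \<in> gromov_boundary \<and> (\<exists>T. \<forall>s\<ge>T. \<forall>t\<ge>T. R - 1 - 2 * c \<le> gromov_product b (\<gamma> s) (\<sigma> t))"
proof -
  obtain \<gamma>' \<sigma>' where r: "\<gamma>' \<in> \<eta>" "\<sigma>' \<in> \<zeta>" and \<zeta>: "\<zeta> \<in> gromov_boundary" and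
    L: "ereal R \<le> Liminf (at_top \<times>\<^sub>F at_top) (\<lambda>(s, t). ereal (gromov_product b (\<gamma>' s) (\<sigma>' t)))"
    using assms(4) unfolding gromov_nhd_def by blast
  have "ereal (R - 1) < Liminf (at_top \<times>\<^sub>F at_top) (\<lambda>(s, t). ereal (gromov_product b (\<gamma>' s) (\<sigma>' t)))"
    using L by (rule less_le_trans[rotated]) simp
  from less_LiminfD[OF this] obtain T1 where
    T1: "\<And>s t. s \<ge> T1 \<Longrightarrow> t \<ge> T1 \<Longrightarrow> R - 1 \<le> gromov_product b (\<gamma>' s) (\<sigma>' t)"
    by (force simp: eventually_at_top_prod_real intro: less_imp_le)
  obtain T2 where T2: "\<And>s t. s \<ge> T2 \<Longrightarrow> t \<ge> T2 \<Longrightarrow> R - 1 \<le> gromov_product b (\<gamma> s) (\<gamma>' t)"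
    using asymptotic_gromov_product[OF gromov_boundary_asymptotic[OF assms(3,5) r(1)]] by blast
  obtain T3 where T3: "\<And>s t. s \<ge> T3 \<Longrightarrow> t \<ge> T3 \<Longrightarrow> R - 1 - c \<le> gromov_product b (\<sigma>' s) (\<sigma> t)"
    using asymptotic_gromov_product[OF gromov_boundary_asymptotic[OF \<zeta> r(2) assms(6)]] by blast
  define T where "T = max T1 (max T2 T3)"
  have "R - 1 - 2 * c \<le> gromov_product b (\<gamma> s) (\<sigma> t)" if "s \<ge> T" "t \<ge> T" for s t
  proof -
    \<comment> \<open>The chain runs from \<open>\<gamma> s\<close> through
      \<open>\<gamma>' T\<close> and \<open>\<sigma>' T\<close> to \<open>\<sigma> t\<close>, with
      \<open>T\<close> beyond all three thresholds. Each of the two interior points costs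
      \<open>c\<close>.\<close>
    have "R - 1 - c \<le> gromov_product b (\<gamma> s) (\<sigma>' T)"
      using that by (intro four_point_hyperbolicD[OF hyp T2[of s T] T1]) (auto simp: T_def)
    moreover have "R - 1 - c \<le> gromov_product b (\<sigma>' T) (\<sigma> t)"
      using that by (intro T3) (auto simp: T_def)
    ultimately show ?thesis using four_point_hyperbolicD[OF hyp] by fastforce
  qed
  with \<zeta> show ?thesis by blast
qed

lemma gromov_nhd_self:
  assumes "\<eta> \<in> gromov_boundary"
  shows "Inr \<eta> \<in> gromov_nhd b \<eta> R"
proof -
  obtain \<gamma> where \<gamma>: "\<gamma> \<in> \<eta>" using gromov_boundary_nonempty[OF assms] ..
  show ?thesis
    using asymptotic_gromov_product[OF gromov_boundary_asymptotic[OF assms \<gamma> \<gamma>], of R b]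
      gromov_nhd_InrI[OF assms \<gamma> \<gamma>] by blast
qed

lemma gromov_nhd_ray:
  assumes "\<eta> \<in> gromov_boundary" "\<gamma> \<in> \<eta>"
  shows "\<forall>\<^sub>F t in at_top. Inl (\<gamma> t) \<in> gromov_nhd b \<eta> R"
proof -
  obtain T where "\<forall>s\<ge>T. \<forall>t\<ge>T. R \<le> gromov_product b (\<gamma> s) (\<gamma> t)"
    using asymptotic_gromov_product[OF gromov_boundary_asymptotic[OF assms assms(2)], of R b] by blast
  then show ?thesis
    unfolding eventually_at_top_linorder using gromov_nhd_InlI[OF assms(2), of T R b] by blast
qed

text \<open>Moving a point by \<open>D\<close> lowers its products by at most \<open>D\<close>; the
  remaining margin \<open>1 + c\<close> pays for evaluating them along one fixed ray.\<close>

lemma gromov_nhd_change_point: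
  fixes x :: "'a::metric_space"
  assumes "four_point_hyperbolic TYPE('a) c" "\<eta> \<in> gromov_boundary"
    and "Inl x \<in> gromov_nhd b \<eta> (R + 1 + c + D)" "dist x y \<le> D"
  shows "Inl y \<in> gromov_nhd b \<eta> R"
proof -
  obtain \<gamma> where \<gamma>: "\<gamma> \<in> \<eta>" using gromov_boundary_nonempty[OF assms(2)] ..
  obtain T where T: "\<And>t. t \<ge> T \<Longrightarrow> R + D \<le> gromov_product b x (\<gamma> t)"
    using gromov_nhd_InlD[OF assms(1-3) \<gamma>] by auto
  have "R \<le> gromov_product b y (\<gamma> t)" if "t \<ge> T" for t
    using T[OF that] gromov_product_change_point[of b x "\<gamma> t" y] assms(4) by linarith
  then show ?thesis by (rule gromov_nhd_InlI[OF \<gamma>])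
qed

text \<open>Openness at a boundary point is demanded for every base point; this inclusion reduces
  the check to a single one.\<close>

lemma gromov_nhd_change_base:
  fixes b :: "'a::metric_space"
  assumes "four_point_hyperbolic TYPE('a) c" "c \<ge> 0" "\<eta> \<in> gromov_boundary"
  shows "gromov_nhd b' \<eta> (R + 1 + 2 * c + dist b' b) \<subseteq> gromov_nhd b \<eta> R"
proof
  fix q assume q: "q \<in> gromov_nhd b' \<eta> (R + 1 + 2 * c + dist b' b)"
  obtain \<gamma> where \<gamma>: "\<gamma> \<in> \<eta>" using gromov_boundary_nonempty[OF assms(3)] ..
  show "q \<in> gromov_nhd b \<eta> R"
  proof (cases q)
    case (Inl x)
    obtain T where T: "\<And>t. t \<ge> T \<Longrightarrow> R + c + dist b' b \<le> gromov_product b' x (\<gamma> t)"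
      using gromov_nhd_InlD[OF assms(1,3) q[unfolded Inl] \<gamma>] by (auto simp: algebra_simps)
    have "R \<le> gromov_product b x (\<gamma> t)" if "t \<ge> T" for t
      using T[OF that] gromov_product_change_base[of b' x "\<gamma> t" b] \<open>c \<ge> 0\<close> by linarith
    then show ?thesis unfolding Inl by (rule gromov_nhd_InlI[OF \<gamma>])
  next
    case (Inr \<zeta>)
    have \<zeta>: "\<zeta> \<in> gromov_boundary" using q unfolding Inr gromov_nhd_def by auto
    obtain \<sigma> where \<sigma>: "\<sigma> \<in> \<zeta>" using gromov_boundary_nonempty[OF \<zeta>] ..
    obtain T where T: "\<And>s t. s \<ge> T \<Longrightarrow> t \<ge> T \<Longrightarrow> R + dist b' b \<le> gromov_product b' (\<gamma> s) (\<sigma> t)"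
      using gromov_nhd_InrD[OF assms q[unfolded Inr] \<gamma> \<sigma>] by (auto simp: algebra_simps)
    have "R \<le> gromov_product b (\<gamma> s) (\<sigma> t)" if "s \<ge> T" "t \<ge> T" for s t
      using T[OF that] gromov_product_change_base[of b' "\<gamma> s" "\<sigma> t" b] by linarith
    then show ?thesis unfolding Inr by (rule gromov_nhd_InrI[OF \<zeta> \<gamma> \<sigma>])
  qed
qed

text \<open>A weak triangle inequality at infinity: a point far along \<zeta> is far along \<eta>
  once \<zeta> is close to \<eta>. Reading off the products costs at most \<open>1 + 2 * c\<close>,
  and the last \<open>c\<close> pays for joining them through a far point of a ray in
  \<zeta>.\<close>

lemma gromov_nhd_trans:
  fixes b :: "'a::metric_space"
  assumes hyp: "four_point_hyperbolic TYPE('a) c" "c \<ge> 0" and \<eta>: "\<eta> \<in> gromov_boundary"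
    and \<zeta>: "Inr \<zeta> \<in> gromov_nhd b \<eta> (R + 1 + 3 * c)"
  shows "gromov_nhd b \<zeta> (R + 1 + 3 * c) \<subseteq> gromov_nhd b \<eta> R"
proof
  fix q assume q: "q \<in> gromov_nhd b \<zeta> (R + 1 + 3 * c)"
  have \<zeta>': "\<zeta> \<in> gromov_boundary" using \<zeta> unfolding gromov_nhd_def by auto
  obtain \<gamma> where \<gamma>: "\<gamma> \<in> \<eta>" using gromov_boundary_nonempty[OF \<eta>] ..
  obtain \<sigma> where \<sigma>: "\<sigma> \<in> \<zeta>" using gromov_boundary_nonempty[OF \<zeta>'] ..
  obtain T1 where T1: "\<And>s t. s \<ge> T1 \<Longrightarrow> t \<ge> T1 \<Longrightarrow> R + c \<le> gromov_product b (\<gamma> s) (\<sigma> t)"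
    using gromov_nhd_InrD[OF hyp \<eta> \<zeta> \<gamma> \<sigma>] by (auto simp: algebra_simps)
  show "q \<in> gromov_nhd b \<eta> R"
  proof (cases q)
    case (Inl x)
    obtain T2 where T2: "\<And>t. t \<ge> T2 \<Longrightarrow> R + 2 * c \<le> gromov_product b x (\<sigma> t)"
      using gromov_nhd_InlD[OF hyp(1) \<zeta>' q[unfolded Inl] \<sigma>] by (auto simp: algebra_simps)
    define T where "T = max T1 T2"
    have "R \<le> gromov_product b x (\<gamma> t)" if "t \<ge> T" for t
    proof -
      have "R + c \<le> gromov_product b x (\<sigma> T)" using T2[of T] \<open>c \<ge> 0\<close> by (simp add: T_def)
      moreover have "R + c \<le> gromov_product b (\<sigma> T) (\<gamma> t)"
        using T1[of t T] that by (simp add: T_def gromov_product_commute)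
      ultimately show ?thesis using four_point_hyperbolicD[OF hyp(1)] by fastforce
    qed
    then show ?thesis unfolding Inl by (rule gromov_nhd_InlI[OF \<gamma>])
  next
    case (Inr \<omega>)
    have \<omega>: "\<omega> \<in> gromov_boundary" using q unfolding Inr gromov_nhd_def by auto
    obtain \<tau> where \<tau>: "\<tau> \<in> \<omega>" using gromov_boundary_nonempty[OF \<omega>] ..
    obtain T2 where T2: "\<And>s t. s \<ge> T2 \<Longrightarrow> t \<ge> T2 \<Longrightarrow> R + c \<le> gromov_product b (\<sigma> s) (\<tau> t)"
      using gromov_nhd_InrD[OF hyp \<zeta>' q[unfolded Inr] \<sigma> \<tau>] by (auto simp: algebra_simps)
    define T where "T = max T1 T2"
    have "R \<le> gromov_product b (\<gamma> s) (\<tau> t)" if "s \<ge> T" "t \<ge> T" for s t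
      using four_point_hyperbolicD[OF hyp(1) T1[of s T] T2[of T t]] that by (simp add: T_def)
    then show ?thesis unfolding Inr by (rule gromov_nhd_InrI[OF \<omega> \<gamma> \<tau>])
  qed
qed

text \<open>The witness is the interior of the basic neighbourhood; as these sets need not be open
  themselves, hyperbolicity is required.\<close>

lemma gromov_nhd_contains_open:
  fixes b :: "'a::metric_space"
  assumes hyp: "four_point_hyperbolic TYPE('a) c" "c \<ge> 0" and \<eta>: "\<eta> \<in> gromov_boundary"
  shows "\<exists>U. gromov_open U \<and> Inr \<eta> \<in> U \<and> U \<subseteq> gromov_nhd b \<eta> R"
proof -
  define N where "N = gromov_nhd b \<eta> R"
  define U where "U = Inl ` interior {x. Inl x \<in> N} \<union>
    Inr ` {\<zeta> \<in> gromov_boundary. \<exists>r. gromov_nhd b \<zeta> r \<subseteq> N}"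
  have "U \<subseteq> N"
    using interior_subset[of "{x. Inl x \<in> N}"] gromov_nhd_self[of _ b] by (fastforce simp: U_def)
  moreover have "Inr \<eta> \<in> U" using \<eta> by (auto simp: U_def N_def)
  moreover have "gromov_open U"
    unfolding gromov_open_def
  proof (intro conjI allI impI)
    show "U \<subseteq> range Inl \<union> Inr ` gromov_boundary" by (auto simp: U_def)
    have "{x. Inl x \<in> U} = interior {x. Inl x \<in> N}" by (auto simp: U_def)
    then show "open {x. Inl x \<in> U}" by simp
  next
    fix \<zeta> b' assume "Inr \<zeta> \<in> U"
    then obtain r where \<zeta>: "\<zeta> \<in> gromov_boundary" and r: "gromov_nhd b \<zeta> r \<subseteq> N"
      by (auto simp: U_def)
    \<comment> \<open>Large enough for both cases below: \<open>r + 2 + c\<close> lets a point of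
      \<open>X\<close> move within its unit ball, and \<open>r + 1 + 3 * c\<close> is what
      \<open>gromov_nhd_trans\<close> requires.\<close>
    define r' where "r' = r + 2 + 3 * c"
    have "gromov_nhd b \<zeta> r' \<subseteq> U"
    proof
      fix q assume q: "q \<in> gromov_nhd b \<zeta> r'"
      show "q \<in> U"
      proof (cases q)
        case (Inl x)
        have "r + 1 + c + 1 \<le> r'" using \<open>c \<ge> 0\<close> by (simp add: r'_def)
        with q have q': "Inl x \<in> gromov_nhd b \<zeta> (r + 1 + c + 1)"
          unfolding Inl using gromov_nhd_antimono by blast
        have "Inl y \<in> N" if "y \<in> ball x 1" for y
          using gromov_nhd_change_point[OF hyp(1) \<zeta> q', of y] that r by auto
        then have "x \<in> interior {x. Inl x \<in> N}"
          by (intro interiorI[of "ball x 1"]) auto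
        then show ?thesis unfolding Inl U_def by blast
      next
        case (Inr \<omega>)
        have \<omega>: "\<omega> \<in> gromov_boundary" using q unfolding Inr gromov_nhd_def by auto
        have "r + 1 + 3 * c \<le> r'" by (simp add: r'_def)
        with q have "Inr \<omega> \<in> gromov_nhd b \<zeta> (r + 1 + 3 * c)"
          unfolding Inr using gromov_nhd_antimono by blast
        from gromov_nhd_trans[OF hyp \<zeta> this] r \<omega> show ?thesis unfolding Inr U_def by blast
      qed
    qed
    with gromov_nhd_change_base[OF hyp \<zeta>, of b' r' b] show "\<exists>R. gromov_nhd b' \<zeta> R \<subseteq> U" by blast
  qed
  ultimately show ?thesis unfolding N_def by blast
qed

section \<open>Filters and limits at a boundary point\<close>

lemma eventually_nhdsin_gromov:
  fixes b :: "'a::metric_space"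
  assumes hyp: "four_point_hyperbolic TYPE('a) c" "c \<ge> 0" and \<eta>: "\<eta> \<in> gromov_boundary"
  shows "eventually P (nhdsin gromov_compactification (Inr \<eta>)) \<longleftrightarrow>
    (\<exists>R. \<forall>q\<in>gromov_nhd b \<eta> R. P q)"
proof -
  have "eventually P (nhdsin gromov_compactification (Inr \<eta>)) \<longleftrightarrow>
      (\<exists>U. gromov_open U \<and> Inr \<eta> \<in> U \<and> (\<forall>q\<in>U. P q))"
    using \<eta> by (simp add: eventually_nhdsin topspace_gromov_compactification
        openin_gromov_compactification)
  also have "\<dots> \<longleftrightarrow> (\<exists>R. \<forall>q\<in>gromov_nhd b \<eta> R. P q)"
  proof
    assume "\<exists>U. gromov_open U \<and> Inr \<eta> \<in> U \<and> (\<forall>q\<in>U. P q)"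
    then obtain U R where "gromov_nhd b \<eta> R \<subseteq> U" "\<forall>q\<in>U. P q"
      unfolding gromov_open_def by metis
    then show "\<exists>R. \<forall>q\<in>gromov_nhd b \<eta> R. P q" by blast
  next
    assume "\<exists>R. \<forall>q\<in>gromov_nhd b \<eta> R. P q"
    then show "\<exists>U. gromov_open U \<and> Inr \<eta> \<in> U \<and> (\<forall>q\<in>U. P q)"
      using gromov_nhd_contains_open[OF hyp \<eta>] by (meson subsetD)
  qed
  finally show ?thesis .
qed

lemma eventually_to_boundary:
  fixes b :: "'a::metric_space"
  assumes "four_point_hyperbolic TYPE('a) c" "c \<ge> 0" and "\<eta> \<in> gromov_boundary"
  shows "eventually P (to_boundary \<eta>) \<longleftrightarrow> (\<exists>R. \<forall>x. Inl x \<in> gromov_nhd b \<eta> R \<longrightarrow> P x)"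
proof
  assume "eventually P (to_boundary \<eta>)"
  then obtain Q R where "\<forall>q\<in>gromov_nhd b \<eta> R. Q q" "\<forall>x. Q (Inl x) \<longrightarrow> P x"
    unfolding to_boundary_def eventually_filtercomap eventually_nhdsin_gromov[OF assms, of _ b] by blast
  then show "\<exists>R. \<forall>x. Inl x \<in> gromov_nhd b \<eta> R \<longrightarrow> P x" by blast
next
  assume "\<exists>R. \<forall>x. Inl x \<in> gromov_nhd b \<eta> R \<longrightarrow> P x"
  then obtain R where R: "\<And>x. Inl x \<in> gromov_nhd b \<eta> R \<Longrightarrow> P x" by blast
  have "eventually (\<lambda>q. q \<in> gromov_nhd b \<eta> R) (nhdsin gromov_compactification (Inr \<eta>))"
    unfolding eventually_nhdsin_gromov[OF assms, of _ b] by blast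
  with R show "eventually P (to_boundary \<eta>)"
    unfolding to_boundary_def eventually_filtercomap by blast
qed

lemma limitin_gromov_boundary:
  fixes b :: "'a::metric_space"
  assumes "four_point_hyperbolic TYPE('a) c" "c \<ge> 0" and \<eta>: "\<eta> \<in> gromov_boundary"
  shows "limitin gromov_compactification u (Inr \<eta>) F \<longleftrightarrow>
    (\<forall>R. \<forall>\<^sub>F n in F. u n \<in> gromov_nhd b \<eta> R)"
proof
  assume L: "limitin gromov_compactification u (Inr \<eta>) F"
  show "\<forall>R. \<forall>\<^sub>F n in F. u n \<in> gromov_nhd b \<eta> R"
  proof
    fix R
    obtain U where U: "gromov_open U" "Inr \<eta> \<in> U" "U \<subseteq> gromov_nhd b \<eta> R"
      using gromov_nhd_contains_open[OF assms] by blast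
    then have "\<forall>\<^sub>F n in F. u n \<in> U"
      using L by (simp add: limitin_def openin_gromov_compactification)
    then show "\<forall>\<^sub>F n in F. u n \<in> gromov_nhd b \<eta> R"
      using U(3) by (auto elim: eventually_mono)
  qed
next
  assume N: "\<forall>R. \<forall>\<^sub>F n in F. u n \<in> gromov_nhd b \<eta> R"
  have "\<forall>\<^sub>F n in F. u n \<in> U" if "gromov_open U" "Inr \<eta> \<in> U" for U
  proof -
    obtain R where "gromov_nhd b \<eta> R \<subseteq> U" using \<open>gromov_open U\<close> \<open>Inr \<eta> \<in> U\<close> unfolding gromov_open_def by blast
    then show ?thesis using N by (auto elim!: eventually_mono allE[of _ R])
  qed
  then show "limitin gromov_compactification u (Inr \<eta>) F"
    using \<eta> by (simp add: limitin_def topspace_gromov_compactification openin_gromov_compactification)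
qed

section \<open>Displacement along a ray\<close>

text \<open>The ray \<gamma> itself tends to \<eta>, and along it the difference of distances is at
  most the displacement. A lower limit exceeding \<open>B\<close> would contradict this at a far
  point of \<gamma>.\<close>

lemma log_dilation_le_displacement:
  fixes g :: "'a::metric_space \<Rightarrow> 'a"
  assumes "four_point_hyperbolic TYPE('a) c" "c \<ge> 0" and \<eta>: "\<eta> \<in> gromov_boundary" "\<gamma> \<in> \<eta>"
    and B: "\<And>t. t \<ge> 0 \<Longrightarrow> dist (g (\<gamma> t)) (\<gamma> t) \<le> B"
  shows "log_dilation \<eta> p g \<le> ereal B"
proof (rule ccontr)
  assume "\<not> ?thesis"
  then have "\<forall>\<^sub>F z in to_boundary \<eta>. ereal B < ereal (dist z p - dist (g z) p)"
    unfolding log_dilation_def by (intro less_LiminfD) simp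
  then obtain R where R: "\<And>z. Inl z \<in> gromov_nhd p \<eta> R \<Longrightarrow> B < dist z p - dist (g z) p"
    by (auto simp: eventually_to_boundary[OF assms(1-3), of _ p])
  have "\<forall>\<^sub>F t in at_top. Inl (\<gamma> t) \<in> gromov_nhd p \<eta> R \<and> t \<ge> 0"
    by (intro eventually_conj gromov_nhd_ray[OF \<eta>] eventually_ge_at_top)
  then obtain t where t: "Inl (\<gamma> t) \<in> gromov_nhd p \<eta> R" "t \<ge> 0"
    using eventually_happens'[OF trivial_limit_at_top_linorder] by blast
  show False
    using R[OF t(1)] B[OF t(2)] dist_triangle[of "\<gamma> t" p "g (\<gamma> t)"] by (simp add: dist_commute)
qed

text \<open>Bounded displacement on one ray extends to every geodesic region with vertex \<eta>, and
  moving a sequence by a bounded amount does not change its limit in the boundary.\<close>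

lemma has_geodesic_limit_of_displacement:
  fixes g :: "'a::metric_space \<Rightarrow> 'a"
  assumes hyp: "four_point_hyperbolic TYPE('a) c" "c \<ge> 0" and \<eta>: "\<eta> \<in> gromov_boundary" "\<gamma> \<in> \<eta>"
    and g: "\<And>x y. dist (g x) (g y) \<le> dist x y"
    and B: "\<And>t. t \<ge> 0 \<Longrightarrow> dist (g (\<gamma> t)) (\<gamma> t) \<le> B"
  shows "has_geodesic_limit g (Inr \<eta>) \<eta>"
  unfolding has_geodesic_limit_def
proof (intro ballI allI impI)
  fix \<sigma> R and x :: "nat \<Rightarrow> 'a"
  assume \<sigma>: "\<sigma> \<in> \<eta>" and x: "\<forall>n. x n \<in> geodesic_region \<sigma> R"
    and lim: "limitin gromov_compactification (\<lambda>n. Inl (x n)) (Inr \<eta>) sequentially"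
  obtain C where C: "\<And>t. t \<ge> 0 \<Longrightarrow> dist (\<gamma> t) (\<sigma> t) \<le> C"
    using gromov_boundary_asymptotic[OF \<eta> \<sigma>] by (auto simp: asymptotic_def)
  \<comment> \<open>The path from \<open>x n\<close> to \<open>g (x n)\<close> goes to a point of
    \<gamma> within \<open>C + R\<close>, then to its image within \<open>B\<close>, and back within
    \<open>C + R\<close> because \<open>g\<close> is non-expanding.\<close>
  define D where "D = B + 2 * (C + R)"
  have D: "dist (x n) (g (x n)) \<le> D" for n
  proof -
    \<comment> \<open>Written as an infimum, the strict bound on the distance to the ray yields an
      actual point of the ray closer than \<open>R\<close>.\<close>
    have "Inf {dist (x n) a | a. a \<in> \<sigma> ` {0..}} < R"
      using x by (simp add: geodesic_region_def infdist_notempty Setcompr_eq_image)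
    then obtain t where t: "t \<ge> 0" "dist (x n) (\<sigma> t) < R"
      by (auto dest!: cInf_lessD[rotated])
    have "dist (x n) (\<gamma> t) \<le> C + R"
      using C[OF t(1)] t(2) dist_triangle[of "x n" "\<gamma> t" "\<sigma> t"] by (simp add: dist_commute)
    then show ?thesis
      using B[OF t(1)] g[of "x n" "\<gamma> t"] dist_triangle[of "x n" "g (x n)" "\<gamma> t"]
        dist_triangle[of "\<gamma> t" "g (x n)" "g (\<gamma> t)"]
      by (simp add: D_def dist_commute)
  qed
  show "limitin gromov_compactification (\<lambda>n. Inl (g (x n))) (Inr \<eta>) sequentially"
    unfolding limitin_gromov_boundary[OF hyp \<eta>(1), of _ _ "\<gamma> 0"]
  proof
    fix r
    have "\<forall>\<^sub>F n in sequentially. Inl (x n) \<in> gromov_nhd (\<gamma> 0) \<eta> (r + 1 + c + D)"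
      using lim unfolding limitin_gromov_boundary[OF hyp \<eta>(1), of _ _ "\<gamma> 0"] by blast
    then show "\<forall>\<^sub>F n in sequentially. Inl (g (x n)) \<in> gromov_nhd (\<gamma> 0) \<eta> r"
      by (rule eventually_mono) (rule gromov_nhd_change_point[OF hyp(1) \<eta>(1) _ D])
  qed
qed

lemma gromov_product_ray:
  assumes "geodesic_ray \<gamma>" "0 \<le> s" "s \<le> t"
  shows "gromov_product (\<gamma> 0) (\<gamma> s) (\<gamma> t) = s"
  using assms by (simp add: geodesic_ray_def gromov_product_def)

text \<open>A sequence tending to \<open>\<eta>\<close> along which \<open>f\<close> loses only a bounded amount of distance to
  \<open>\<gamma> 0\<close> forces the same along \<open>\<gamma>\<close>.\<close>

lemma dist_image_ray_lower_bound:
  fixes f :: "'a::metric_space \<Rightarrow> 'a"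
  assumes hyp: "four_point_hyperbolic TYPE('a) c" "c \<ge> 0" and \<eta>: "\<eta> \<in> gromov_boundary" "\<gamma> \<in> \<eta>"
    and f: "\<And>x y. dist (f x) (f y) \<le> dist x y"
    and fin: "log_dilation \<eta> (\<gamma> 0) f < \<infinity>"
  shows "\<exists>A. \<forall>t\<ge>0. t - A \<le> dist (f (\<gamma> t)) (\<gamma> 0)"
proof -
  have ray: "geodesic_ray \<gamma>" using gromov_boundary_geodesic_ray[OF \<eta>] .
  obtain K where K: "log_dilation \<eta> (\<gamma> 0) f < ereal K"
    using ereal_dense2[OF fin] by auto
  have "t - (K + 2 * c) \<le> dist (f (\<gamma> t)) (\<gamma> 0)" if "t \<ge> 0" for t
  proof -
    \<comment> \<open>The radius \<open>t + 1 + c\<close> is chosen so that the products of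
      \<open>z\<close> with far points of \<gamma> are at least \<open>t\<close>. Then \<gamma>
      passes, at time \<open>t\<close>, near a geodesic from \<open>\<gamma> 0\<close> to
      \<open>z\<close>.\<close>
    have "\<exists>z. Inl z \<in> gromov_nhd (\<gamma> 0) \<eta> (t + 1 + c) \<and> dist z (\<gamma> 0) - dist (f z) (\<gamma> 0) < K"
    proof (rule ccontr)
      assume "\<not> ?thesis"
      then have "\<forall>\<^sub>F z in to_boundary \<eta>. ereal K \<le> ereal (dist z (\<gamma> 0) - dist (f z) (\<gamma> 0))"
        by (auto simp: eventually_to_boundary[OF hyp \<eta>(1), of _ "\<gamma> 0"] not_less)
      then have "ereal K \<le> log_dilation \<eta> (\<gamma> 0) f"
        unfolding log_dilation_def by (rule Liminf_bounded)
      with K show False by simp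
    qed
    then obtain z where z: "Inl z \<in> gromov_nhd (\<gamma> 0) \<eta> (t + 1 + c)"
      "dist z (\<gamma> 0) - dist (f z) (\<gamma> 0) < K" by blast
    obtain T where T: "\<And>s. s \<ge> T \<Longrightarrow> t \<le> gromov_product (\<gamma> 0) z (\<gamma> s)"
      using gromov_nhd_InlD[OF hyp(1) \<eta>(1) z(1) \<eta>(2)] by auto
    have "t \<le> gromov_product (\<gamma> 0) (\<gamma> (max t T)) (\<gamma> t)"
      using gromov_product_ray[OF ray \<open>t \<ge> 0\<close>, of "max t T"] by (simp add: gromov_product_commute)
    then have "t - c \<le> gromov_product (\<gamma> 0) z (\<gamma> t)"
      by (intro four_point_hyperbolicD[OF hyp(1) T[of "max t T"]]) auto
    moreover have "dist (\<gamma> t) (\<gamma> 0) = t" using ray \<open>t \<ge> 0\<close> by (simp add: geodesic_ray_def)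
    ultimately have "dist z (\<gamma> t) \<le> dist z (\<gamma> 0) - t + 2 * c"
      by (simp add: gromov_product_def field_simps)
    \<comment> \<open>\<open>f z\<close> has lost less than \<open>K\<close> of the distance of
      \<open>z\<close> to \<open>\<gamma> 0\<close>, while \<open>f (\<gamma> t)\<close> is no
      further from \<open>f z\<close> than \<open>\<gamma> t\<close> is from \<open>z\<close>. What
      remains for \<open>f (\<gamma> t)\<close> is at least \<open>t - K - 2 * c\<close>.\<close>
    then show ?thesis
      using z(2) f[of z "\<gamma> t"] dist_triangle[of "f z" "\<gamma> 0" "f (\<gamma> t)"] by linarith
  qed
  then show ?thesis by blast
qed

text \<open>Both \<open>f (\<gamma> s)\<close> and \<open>\<gamma> s\<close> have product at least
  about \<open>s\<close> with a far image point \<open>f (\<gamma> n)\<close>, hence with each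
  other. As both lie at distance at most about \<open>s\<close> from \<open>\<gamma> 0\<close>, they
  are close.\<close>

lemma brfp_displacement_bounded:
  fixes f :: "'a::metric_space \<Rightarrow> 'a"
  assumes hyp: "four_point_hyperbolic TYPE('a) c" "c \<ge> 0"
    and f: "\<And>x y. dist (f x) (f y) \<le> dist x y"
    and brfp: "boundary_regular_fixed_point f \<eta>" and \<gamma>: "\<gamma> \<in> \<eta>"
  shows "\<exists>B. \<forall>t\<ge>0. dist (f (\<gamma> t)) (\<gamma> t) \<le> B"
proof -
  have \<eta>: "\<eta> \<in> gromov_boundary" and fin: "log_dilation \<eta> (\<gamma> 0) f < \<infinity>"
    and geo: "has_geodesic_limit f (Inr \<eta>) \<eta>"
    using brfp by (auto simp: boundary_regular_fixed_point_def)
  have ray: "geodesic_ray \<gamma>" using gromov_boundary_geodesic_ray[OF \<eta> \<gamma>] .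
  obtain A where A: "\<And>t. t \<ge> 0 \<Longrightarrow> t - A \<le> dist (f (\<gamma> t)) (\<gamma> 0)"
    using dist_image_ray_lower_bound[OF hyp \<eta> \<gamma> f fin] by blast
  \<comment> \<open>The geodesic limit is stated for sequences, so \<gamma> is sampled at integer
    times; any positive radius would do for the region.\<close>
  have region: "\<forall>n. \<gamma> (real n) \<in> geodesic_region \<gamma> 1"
    by (auto simp: geodesic_region_def)
  have "limitin gromov_compactification (\<lambda>n. Inl (\<gamma> (real n))) (Inr \<eta>) sequentially"
    unfolding limitin_gromov_boundary[OF hyp \<eta>, of _ _ "\<gamma> 0"]
    using eventually_compose_filterlim[OF gromov_nhd_ray[OF \<eta> \<gamma>] filterlim_real_sequentially] by blast
  then have "limitin gromov_compactification (\<lambda>n. Inl (f (\<gamma> (real n)))) (Inr \<eta>) sequentially"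
    using geo \<gamma> region unfolding has_geodesic_limit_def by (meson zero_less_one)
  then have lim: "\<forall>\<^sub>F n in sequentially. Inl (f (\<gamma> (real n))) \<in> gromov_nhd (\<gamma> 0) \<eta> r" for r
    unfolding limitin_gromov_boundary[OF hyp \<eta>, of _ _ "\<gamma> 0"] by blast
  have "dist (f (\<gamma> s)) (\<gamma> s) \<le> dist (f (\<gamma> 0)) (\<gamma> 0) + 2 * \<bar>A\<bar> + 4 * c" if "s \<ge> 0" for s
  proof -
    have "\<forall>\<^sub>F n in sequentially. Inl (f (\<gamma> (real n))) \<in> gromov_nhd (\<gamma> 0) \<eta> (s + 1 + c) \<and> real n \<ge> s"
      using lim filterlim_real_sequentially
      by (intro eventually_conj) (auto simp: filterlim_at_top)
    then obtain n where n: "Inl (f (\<gamma> (real n))) \<in> gromov_nhd (\<gamma> 0) \<eta> (s + 1 + c)" "real n \<ge> s"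
      using eventually_happens'[OF sequentially_bot] by blast
    obtain T where T: "\<And>t. t \<ge> T \<Longrightarrow> s \<le> gromov_product (\<gamma> 0) (f (\<gamma> n)) (\<gamma> t)"
      using gromov_nhd_InlD[OF hyp(1) \<eta> n(1) \<gamma>] by auto
    have "s \<le> gromov_product (\<gamma> 0) (\<gamma> (max s T)) (\<gamma> s)"
      using gromov_product_ray[OF ray \<open>s \<ge> 0\<close>, of "max s T"] by (simp add: gromov_product_commute)
    then have 1: "s - c \<le> gromov_product (\<gamma> 0) (f (\<gamma> n)) (\<gamma> s)"
      by (intro four_point_hyperbolicD[OF hyp(1) T[of "max s T"]]) auto
    have "dist (f (\<gamma> s)) (f (\<gamma> n)) \<le> n - s"
      using f[of "\<gamma> s" "\<gamma> n"] ray that n(2) by (simp add: geodesic_ray_def)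
    \<comment> \<open>The two lower bounds \<open>s - A\<close> and \<open>n - A\<close> minus the
      upper bound \<open>n - s\<close> add up to twice \<open>s - A\<close>.\<close>
    then have 2: "s - A \<le> gromov_product (\<gamma> 0) (f (\<gamma> s)) (f (\<gamma> n))"
      using A[of s] A[of n] that by (simp add: gromov_product_def field_simps)
    \<comment> \<open>\<open>s - \<bar>A\<bar> - c\<close> is a common lower bound for the products
      in 1 and 2, whatever the sign of \<open>A\<close>; the second \<open>c\<close> is the
      four-point loss.\<close>
    have 3: "(s - \<bar>A\<bar> - c) - c \<le> gromov_product (\<gamma> 0) (f (\<gamma> s)) (\<gamma> s)"
      using 1 2 \<open>c \<ge> 0\<close>
      by (intro four_point_hyperbolicD[OF hyp(1), of _ _ "f (\<gamma> s)" "f (\<gamma> n)" "\<gamma> s"]) linarith+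
    have s: "dist (\<gamma> s) (\<gamma> 0) = s" using ray that by (simp add: geodesic_ray_def)
    have "dist (f (\<gamma> s)) (\<gamma> 0) \<le> s + dist (f (\<gamma> 0)) (\<gamma> 0)"
      using s f[of "\<gamma> s" "\<gamma> 0"] dist_triangle[of "f (\<gamma> s)" "\<gamma> 0" "f (\<gamma> 0)"] by linarith
    with 3 s show ?thesis by (simp add: gromov_product_def field_simps)
  qed
  then show ?thesis by blast
qed

section \<open>Iterates\<close>

lemma nonexpanding_funpow:
  fixes f :: "'a::metric_space \<Rightarrow> 'a"
  assumes f: "\<And>x y. dist (f x) (f y) \<le> dist x y"
  shows "dist ((f ^^ n) x) ((f ^^ n) y) \<le> dist x y"
proof (induction n)
  case (Suc n)
  then show ?case using f[of "(f ^^ n) x" "(f ^^ n) y"] by simp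
qed simp

text \<open>One more application of \<open>f\<close> moves \<open>x\<close> to \<open>f x\<close>
  and carries the earlier displacement along without increasing it, so each iterate adds at most
  \<open>dist (f x) x\<close>.\<close>

lemma nonexpanding_funpow_displacement:
  fixes f :: "'a::metric_space \<Rightarrow> 'a"
  assumes f: "\<And>x y. dist (f x) (f y) \<le> dist x y"
  shows "dist ((f ^^ n) x) x \<le> n * dist (f x) x"
proof (induction n)
  case (Suc n)
  have "dist ((f ^^ Suc n) x) x \<le> dist ((f ^^ n) x) x + dist (f x) x"
    using f[of "(f ^^ n) x" x] dist_triangle[of "(f ^^ Suc n) x" x "f x"] by simp
  with Suc show ?case by (simp add: algebra_simps)
qed simp

text \<open>The bound holds at every \<open>z\<close>, not only near \<eta>, by comparing
  \<open>g z\<close> with \<open>g p\<close>.\<close>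

lemma log_dilation_ge_displacement:
  assumes "\<And>x y. dist (g x) (g y) \<le> dist x y"
  shows "ereal (- dist (g p) p) \<le> log_dilation \<eta> p g"
proof -
  have "- dist (g p) p \<le> dist z p - dist (g z) p" for z
    using assms[of z p] dist_triangle[of "g z" p "g p"] by linarith
  then show ?thesis
    unfolding log_dilation_def by (intro Liminf_bounded always_eventually) simp
qed

theorem proposition3p2:
  fixes f :: "'a::metric_space \<Rightarrow> 'a" and p :: 'a and \<eta> :: "(real \<Rightarrow> 'a) set"
  assumes "proper_space TYPE('a)"
    and "geodesic_space TYPE('a)"
    and "gromov_hyperbolic TYPE('a)"
    and "\<And>x y. dist (f x) (f y) \<le> dist x y"
    and "\<eta> \<in> gromov_boundary"
    and "boundary_regular_fixed_point f \<eta>"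
  shows "(\<forall>n\<ge>2. boundary_regular_fixed_point (f ^^ n) \<eta>) \<and>
         (\<exists>C::real. \<forall>n\<ge>1. \<bar>log_dilation \<eta> p (f ^^ n) / ereal (real n)\<bar> \<le> ereal C)"
proof -
  note f = \<open>\<And>x y. dist (f x) (f y) \<le> dist x y\<close> and \<eta> = \<open>\<eta> \<in> gromov_boundary\<close>
  obtain c where hyp: "four_point_hyperbolic TYPE('a) c" "c \<ge> 0"
    using gromov_hyperbolic_four_point assms(2,3) by blast
  obtain \<gamma> where \<gamma>: "\<gamma> \<in> \<eta>" using gromov_boundary_nonempty[OF \<eta>] ..
  obtain B where B: "\<And>t. t \<ge> 0 \<Longrightarrow> dist (f (\<gamma> t)) (\<gamma> t) \<le> B"
    using brfp_displacement_bounded[OF hyp f assms(6) \<gamma>] by blast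
  have Bn: "dist ((f ^^ n) (\<gamma> t)) (\<gamma> t) \<le> n * B" if "t \<ge> 0" for n t
    using nonexpanding_funpow_displacement[of f n "\<gamma> t"] f B[OF that]
    by (meson mult_left_mono of_nat_0_le_iff order_trans)
  have upper: "log_dilation \<eta> q (f ^^ n) \<le> ereal (n * B)" for n q
    using log_dilation_le_displacement[OF hyp \<eta> \<gamma>, of "f ^^ n"] Bn by blast
  have "boundary_regular_fixed_point (f ^^ n) \<eta>" for n
    unfolding boundary_regular_fixed_point_def
  proof (intro conjI allI \<eta>)
    show "log_dilation \<eta> q (f ^^ n) < \<infinity>" for q
      using upper[of q n] by (rule le_less_trans) simp
    show "has_geodesic_limit (f ^^ n) (Inr \<eta>) \<eta>"
      by (rule has_geodesic_limit_of_displacement[OF hyp \<eta> \<gamma> nonexpanding_funpow[OF f] Bn])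
  qed
  \<comment> \<open>Both bounds on the dilation grow linearly in \<open>n\<close>: \<open>B\<close>
    governs it from above and \<open>dist (f p) p\<close> from below, so the larger of the two
    bounds the quotient.\<close>
  moreover have "\<bar>log_dilation \<eta> p (f ^^ n) / ereal (real n)\<bar> \<le> ereal (max B (dist (f p) p))"
    if "n \<ge> 1" for n
  proof -
    have "ereal (- (n * dist (f p) p)) \<le> ereal (- dist ((f ^^ n) p) p)"
      using nonexpanding_funpow_displacement[of f n p] f by simp
    also have "\<dots> \<le> log_dilation \<eta> p (f ^^ n)"
      by (rule log_dilation_ge_displacement[OF nonexpanding_funpow[OF f]])
    finally have lower: "ereal (- (n * dist (f p) p)) \<le> log_dilation \<eta> p (f ^^ n)" .
    \<comment> \<open>Squeezed between two reals, the dilation is finite, and the division can be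
      carried out in the reals.\<close>
    then obtain r where r: "log_dilation \<eta> p (f ^^ n) = ereal r"
      using upper[of p n] by (cases "log_dilation \<eta> p (f ^^ n)") auto
    have "- (n * dist (f p) p) \<le> r" "r \<le> n * B"
      using lower upper[of p n] unfolding r by simp_all
    then have "r / n \<le> B" "- dist (f p) p \<le> r / n"
      using that by (simp_all add: field_simps)
    then show ?thesis using that by (simp add: r abs_le_iff le_max_iff_disj) linarith
  qed
  ultimately show ?thesis by blast
qed

end
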